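(* Let $T, D \ge 1$ be integers, let $\mathbf{\Sigma}_{ST} \in \mathbb{R}^{TD \times TD}$ be a symmetric positive definite matrix, and let $\sigma^2 > 0$. For $Y, \hat{Y} \in \mathbb{R}^{T \times D}$ put $\mathbf{e} = \mathrm{vec}(\hat{Y} - Y) \in \mathbb{R}^{TD}$, and suppose that $\mathbf{e} \sim \mathcal{N}(\mathbf{0}, \mathbf{\Sigma}_{ST})$, with density $p(\cdot)$. Then: (1) Ignoring additive constants independent of the predictions, the scaled negative log-likelihood $-\frac{1}{TD}\log p(\mathbf{e})$ under the true covariance $\mathbf{\Sigma}_{ST}$ is $$\mathcal{L}_{\mathrm{nll}} = \frac{1}{2TD}\, \mathbf{e}^{\top} \mathbf{\Sigma}_{ST}^{-1} \mathbf{e}.$$ (2) The point-wise objective $\mathcal{L}_{\mathrm{df}} = \frac{1}{T}\sum_{t=1}^{T} \frac{1}{D}\| Y_{t,:} - \hat{Y}_{t,:}\|_2^2$ can be written as $$\mathcal{L}_{\mathrm{df}} = \frac{1}{TD}\, \mathbf{e}^{\top}\mathbf{e}.$$ (3) Therefore, compared with the isotropic Gaussian negative log-likelihood under variance $\sigma^2$ (which is $\frac{1}{2\sigma^2}\mathcal{L}_{\mathrm{df}}$ up to additive constants), the discrepancy between the two objectives is $$\Delta = \mathcal{L}_{\mathrm{nll}} - \frac{1}{2\sigma^2}\mathcal{L}_{\mathrm{df}} = \frac{1}{2TD}\, \mathbf{e}^{\top}\left(\mathbf{\Sigma}_{ST}^{-1} - \frac{1}{\sigma^2}\mathbf{I}\right)\mathbf{e},$$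 where $\mathbf{I} \in \mathbb{R}^{TD\times TD}$ is the identity matrix. (4) Whenever cross-variable and lagged dependencies are present, so that the true precision matrix $\mathbf{\Sigma}_{ST}^{-1}$ contains non-zero off-diagonal elements (as the theorem asserts is ensured in real-world multivariate time series), one has $\mathbf{\Sigma}_{ST}^{-1} \ne \frac{1}{\sigma^2}\mathbf{I}$, and consequently the objective gap is strictly non-zero: $\Delta \neq 0$.
   Context: $T$ is the forecast horizon and $D$ the number of variables of a multivariate time series; $Y \in \mathbb{R}^{T\times D}$ is the ground-truth future and $\hat{Y} \in \mathbb{R}^{T \times D}$ is the prediction. $Y_{t,:}$ denotes the $t$-th row of $Y$. $\mathrm{vec}$ flattens a $T \times D$ matrix into a vector in $\mathbb{R}^{TD}$ (in any fixed order of the entries), so $\mathbf{e}$ is the flattened prediction error over the whole horizon and all variables. $\mathcal{N}(\mathbf{0}, \mathbf{\Sigma})$ is the centred multivariate Gaussian distribution with covariance $\mathbf{\Sigma}$. $\mathbf{\Sigma}_{ST}$ is the true spatiotemporal covariance matrix of the residuals, capturing cross-variable and cross-temporal dependencies; it is regarded as fixed and independent of the predictions (model parameters). $\mathcal{L}_{\mathrm{df}}$ is the standard mean squared error objective of direct forecasting. *)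

theory Defs
  imports "HOL-Probability.Probability"
begin

text \<open>
  A \<open>T \<times> D\<close> matrix is an element of \<open>real^'d^'t\<close>, with \<open>T = CARD('t)\<close>, \<open>D = CARD('d)\<close>.
  Its flattening lives in \<open>real^'n\<close>; the order of the entries is a bijection
  \<open>\<phi> :: 'n \<Rightarrow> 't \<times> 'd\<close> between the positions of the vector and the entries of the matrix,
  so that \<open>CARD('n) = T * D\<close>.
\<close>

definition flatten :: "('n \<Rightarrow> 't \<times> 'd) \<Rightarrow> real^'d^'t \<Rightarrow> real^'n" where
  "flatten \<phi> A = (\<chi> i. A $ fst (\<phi> i) $ snd (\<phi> i))"

definition pred_error :: "('n \<Rightarrow> 't \<times> 'd) \<Rightarrow> real^'d^'t \<Rightarrow> real^'d^'t \<Rightarrow> real^'n" where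
  "pred_error \<phi> Y Yhat = flatten \<phi> (Yhat - Y)"

definition sym_pos_def :: "real^'n^'n \<Rightarrow> bool" where
  "sym_pos_def A \<longleftrightarrow> transpose A = A \<and> (\<forall>x. x \<noteq> 0 \<longrightarrow> x \<bullet> (A *v x) > 0)"

definition mv_normal_density :: "real^'n \<Rightarrow> real^'n^'n \<Rightarrow> real^'n \<Rightarrow> real" where
  "mv_normal_density \<mu> \<Sigma> x =
     exp (- ((x - \<mu>) \<bullet> (matrix_inv \<Sigma> *v (x - \<mu>))) / 2) / sqrt ((2 * pi) ^ CARD('n) * det \<Sigma>)"

definition mv_normal_distributed ::
    "'w measure \<Rightarrow> ('w \<Rightarrow> real^'n) \<Rightarrow> real^'n \<Rightarrow> real^'n^'n \<Rightarrow> bool" where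
  "mv_normal_distributed M X \<mu> \<Sigma> \<longleftrightarrow>
     distributed M lborel X (\<lambda>x. ennreal (mv_normal_density \<mu> \<Sigma> x))"

definition loss_nll ::
    "('n \<Rightarrow> 't \<times> 'd) \<Rightarrow> real^'n^'n \<Rightarrow> real^'d^'t \<Rightarrow> real^'d^'t \<Rightarrow> real" where
  "loss_nll \<phi> \<Sigma> Y Yhat =
     (let e = pred_error \<phi> Y Yhat
      in 1 / (2 * real CARD('t) * real CARD('d)) * (e \<bullet> (matrix_inv \<Sigma> *v e)))"

definition loss_df :: "real^'d^'t \<Rightarrow> real^'d^'t \<Rightarrow> real" where
  "loss_df Y Yhat =
     1 / real CARD('t) *
       (\<Sum>t\<in>UNIV. 1 / real CARD('d) * (norm (row t Y - row t Yhat))\<^sup>2)"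

definition objective_gap ::
    "('n \<Rightarrow> 't \<times> 'd) \<Rightarrow> real^'n^'n \<Rightarrow> real \<Rightarrow> real^'d^'t \<Rightarrow> real^'d^'t \<Rightarrow> real" where
  "objective_gap \<phi> \<Sigma> \<sigma> Y Yhat =
     loss_nll \<phi> \<Sigma> Y Yhat - 1 / (2 * \<sigma>\<^sup>2) * loss_df Y Yhat"

end

theory Submission
  imports Defs
begin

text \<open>
  Only the almost sure non-vanishing of the gap needs an idea. The gap is a quadratic form in the
  error whose matrix has a non-zero off-diagonal entry, so by polarization the form is non-zero at
  some vector \<open>v\<close>. Every line through \<open>v\<close> then meets the zero set of the form in at most two points.
  Splitting the zero set according to whether a point is the nearer or the farther zero on its ray
  from \<open>v\<close> gives two closed sets that each ray meets at most once. Both are Lebesgue null, and the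
  error has a Lebesgue density.
\<close>

section \<open>Zero sets of quadratic forms\<close>

lemma quadratic_form_line:
  fixes B :: "real^'n^'n"
  shows "(v + c *\<^sub>R x) \<bullet> (B *v (v + c *\<^sub>R x))
    = v \<bullet> (B *v v) + c * (v \<bullet> (B *v x) + x \<bullet> (B *v v)) + c\<^sup>2 * (x \<bullet> (B *v x))"
  by (simp add: matrix_vector_right_distrib matrix_vector_mult_scaleR inner_add_left inner_add_right
      algebra_simps power2_eq_square)

lemma negligible_quadratic_form_zeros:
  fixes B :: "real^'n^'n"
  assumes "v \<bullet> (B *v v) \<noteq> 0"
  shows "negligible {x. x \<bullet> (B *v x) = 0}"
proof -
  define q where "q x = x \<bullet> (B *v x)" for x
  have cont: "continuous_on UNIV q"
    unfolding q_def
    by (intro continuous_intros linear_continuous_on matrix_vector_mul_bounded_linear)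
  have qv: "(q v)\<^sup>2 > 0"
    using assms by (simp add: q_def)
  \<comment> \<open>The parameters of the two zeros on \<open>c \<mapsto> v + c x\<close> have product \<open>q v / q x\<close>,
    so if one of them is 1 then the other is this quotient.\<close>
  have root: "q v = c * q x" if "q (v + x) = 0" "q (v + c *\<^sub>R x) = 0" "c < 1" for c x
  proof -
    define b where "b = v \<bullet> (B *v x) + x \<bullet> (B *v v)"
    have 1: "q v + b + q x = 0" and 2: "q v + c * b + c\<^sup>2 * q x = 0"
      using that quadratic_form_line[of v 1 x B] quadratic_form_line[of v c x B]
      by (simp_all add: q_def b_def)
    have b: "b = - q v - q x"
      using 1 by simp
    have "(1 - c) * (q v - c * q x) = 0"
      using 2 unfolding b by (simp add: algebra_simps power2_eq_square)
    then show ?thesis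
      using \<open>c < 1\<close> by simp
  qed
  have scale: "q (c *\<^sub>R x) = c\<^sup>2 * q x" for c x
    by (simp add: q_def matrix_vector_mult_scaleR power2_eq_square)
  have sq: "(q v)\<^sup>2 = c * (q v * q x)" if "q v = c * q x" for c x
    by (metis that mult.left_commute power2_eq_square)
  have less: "c * (q v)\<^sup>2 < (q v)\<^sup>2" if "c < 1" for c
    using that qv by simp
  \<comment> \<open>The quotient \<open>q (x - v) / q v\<close> is the reciprocal of the parameter
    of the other zero on the line (0 if there is none). Being at most 1 says that no zero lies
    strictly between \<open>v\<close> and \<open>x\<close>.\<close>
  have "negligible {x. q x = 0 \<and> q v * q (x - v) \<le> (q v)\<^sup>2}"
  proof (rule starlike_negligible_strong[where a = v])
    show "closed {x. q x = 0 \<and> q v * q (x - v) \<le> (q v)\<^sup>2}"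
      by (intro closed_Collect_conj closed_Collect_eq closed_Collect_le continuous_intros
          continuous_on_compose2[OF cont] cont) auto
    fix c :: real and x
    assume c: "0 \<le> c" "c < 1" and x: "v + x \<in> {x. q x = 0 \<and> q v * q (x - v) \<le> (q v)\<^sup>2}"
    show "v + c *\<^sub>R x \<notin> {x. q x = 0 \<and> q v * q (x - v) \<le> (q v)\<^sup>2}"
    proof
      assume "v + c *\<^sub>R x \<in> {x. q x = 0 \<and> q v * q (x - v) \<le> (q v)\<^sup>2}"
      with c x have "(q v)\<^sup>2 = c * (q v * q x)"
        by (intro sq root) auto
      also have "\<dots> \<le> c * (q v)\<^sup>2"
        using x c by (intro mult_left_mono) auto
      finally show False
        using less[OF \<open>c < 1\<close>] by simp
    qed
  qed
  moreover have "negligible {x. q x = 0 \<and> (q v)\<^sup>2 \<le> q v * q (x - v)}"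
  proof (rule starlike_negligible_strong[where a = v])
    show "closed {x. q x = 0 \<and> (q v)\<^sup>2 \<le> q v * q (x - v)}"
      by (intro closed_Collect_conj closed_Collect_eq closed_Collect_le continuous_intros
          continuous_on_compose2[OF cont] cont) auto
    fix c :: real and x
    assume c: "0 \<le> c" "c < 1" and x: "v + x \<in> {x. q x = 0 \<and> (q v)\<^sup>2 \<le> q v * q (x - v)}"
    show "v + c *\<^sub>R x \<notin> {x. q x = 0 \<and> (q v)\<^sup>2 \<le> q v * q (x - v)}"
    proof
      assume cx: "v + c *\<^sub>R x \<in> {x. q x = 0 \<and> (q v)\<^sup>2 \<le> q v * q (x - v)}"
      with c x have "(q v)\<^sup>2 = c * (q v * q x)"
        by (intro sq root) auto
      \<comment> \<open>This time the inequality is taken at the nearer point, where the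
        displacement \<open>c *\<^sub>R x\<close> contributes the factor
        \<open>c\<^sup>2\<close>.\<close>
      moreover have "(q v)\<^sup>2 \<le> c * (c * (q v * q x))"
        using cx by (simp add: scale power2_eq_square mult_ac)
      ultimately show False
        using less[OF \<open>c < 1\<close>] by simp
    qed
  qed
  ultimately have "negligible ({x. q x = 0 \<and> q v * q (x - v) \<le> (q v)\<^sup>2}
      \<union> {x. q x = 0 \<and> (q v)\<^sup>2 \<le> q v * q (x - v)})"
    by (rule negligible_Un)
  then show ?thesis
    by (rule negligible_subset) (auto simp: q_def)
qed

text \<open>By symmetry the value at the sum of the two basis vectors exceeds the sum of their own
  values by twice the entry, so the three values cannot all vanish.\<close>

lemma symmetric_quadratic_form_nonzero:
  fixes B :: "real^'n^'n"
  assumes "transpose B = B" and "B $ i $ j \<noteq> 0"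
  obtains v where "v \<bullet> (B *v v) \<noteq> 0"
proof -
  have entry: "axis k 1 \<bullet> (B *v axis l 1) = B $ k $ l" for k l
    by (simp add: matrix_vector_mult_basis inner_axis' column_def)
  have "B $ j $ i = B $ i $ j"
    using assms(1) by (metis transpose_def vec_lambda_beta)
  then have "(axis i 1 + axis j 1) \<bullet> (B *v (axis i 1 + axis j 1))
      = axis i 1 \<bullet> (B *v axis i 1) + 2 * B $ i $ j + axis j 1 \<bullet> (B *v axis j 1)"
    using quadratic_form_line[of "axis i 1" 1 "axis j 1" B] by (simp add: entry)
  with assms(2) that show ?thesis
    by fastforce
qed

section \<open>Inverse and determinant of a positive definite matrix\<close>

lemma matrix_inv_left:
  fixes A :: "real^'n^'n"
  assumes "invertible A"
  shows "matrix_inv A ** A = mat 1"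
  using someI_ex[OF assms[unfolded invertible_def]] by (simp add: matrix_inv_def)

lemma matrix_inv_eqI:
  fixes A :: "real^'n^'n"
  assumes "A ** B = mat 1"
  shows "matrix_inv A = B"
proof -
  have "invertible A"
    using assms by (auto simp: invertible_right_inverse)
  then show ?thesis
    by (metis assms matrix_inv_left matrix_mul_assoc matrix_mul_lid matrix_mul_rid)
qed

lemma sym_pos_def_invertible:
  assumes "sym_pos_def A"
  shows "invertible A"
proof -
  have "x = 0" if "A *v x = 0" for x
    using assms that unfolding sym_pos_def_def by fastforce
  then show ?thesis
    by (simp add: invertible_left_inverse matrix_left_invertible_ker)
qed

lemma sym_pos_def_scaled_identity:
  assumes "0 < s"
  shows "sym_pos_def (s *\<^sub>R mat 1)"
  using assms
  by (simp add: sym_pos_def_def transpose_scalar flip: scaleR_matrix_vector_assoc)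

lemma matrix_inv_scaled_identity:
  assumes "s \<noteq> 0"
  shows "matrix_inv (s *\<^sub>R mat 1 :: real^'n^'n) = (1 / s) *\<^sub>R mat 1"
  using assms
  by (intro matrix_inv_eqI)
      (simp add: matrix_eq flip: matrix_vector_mul_assoc scaleR_matrix_vector_assoc)

text \<open>Provides a path of invertible matrices from \<open>mat 1\<close> to \<open>A\<close>,
  along which the sign of the determinant is followed.\<close>

lemma sym_pos_def_convex_combination_identity:
  assumes "sym_pos_def A" and "0 \<le> s" and "s \<le> 1"
  shows "sym_pos_def ((1 - s) *\<^sub>R mat 1 + s *\<^sub>R A)"
\<comment> \<open>For \<open>s > 0\<close> strict positivity comes from the \<open>A\<close> term;
  at \<open>s = 0\<close> that term vanishes.\<close>
proof (cases "s = 0")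
  case True
  then show ?thesis
    using sym_pos_def_scaled_identity[of 1] by simp
next
  case False
  have "transpose ((1 - s) *\<^sub>R mat 1 + s *\<^sub>R A) = (1 - s) *\<^sub>R mat 1 + s *\<^sub>R A"
  proof -
    have "A $ i $ j = A $ j $ i" for i j
      using assms(1) unfolding sym_pos_def_def by (metis transpose_def vec_lambda_beta)
    then show ?thesis
      by (simp add: transpose_def vec_eq_iff mat_def)
  qed
  moreover have "0 < x \<bullet> (((1 - s) *\<^sub>R mat 1 + s *\<^sub>R A) *v x)" if "x \<noteq> 0" for x
  proof -
    have "0 < s * (x \<bullet> (A *v x))"
      using assms(1,2) that False by (simp add: sym_pos_def_def)
    moreover have "0 \<le> (1 - s) * (x \<bullet> x)"
      using assms(3) by simp
    ultimately show ?thesis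
      by (simp add: matrix_vector_mult_add_rdistrib inner_add_right flip: scaleR_matrix_vector_assoc)
  qed
  ultimately show ?thesis
    by (simp add: sym_pos_def_def)
qed

text \<open>Along the segment from \<open>mat 1\<close> to \<open>A\<close> the determinant is
  continuous, starts at 1 and never vanishes, so it cannot change sign.\<close>

lemma sym_pos_def_det_pos:
  fixes A :: "real^'n^'n"
  assumes "sym_pos_def A"
  shows "0 < det A"
proof (rule ccontr)
  assume "\<not> 0 < det A"
  define f where "f s = det ((1 - s) *\<^sub>R mat 1 + s *\<^sub>R A)" for s
  have "continuous_on {0..1} f"
    unfolding f_def det_def by (auto intro!: continuous_intros)
  moreover have "f 0 = 1" "f 1 \<le> 0"
    using \<open>\<not> 0 < det A\<close> by (simp_all add: f_def)
  ultimately obtain s where s: "0 \<le> s" "s \<le> 1" "f s = 0"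
    using IVT2'[of f 1 0 0] by auto
  with sym_pos_def_invertible[OF sym_pos_def_convex_combination_identity[OF assms s(1,2)]]
  show False
    by (simp add: invertible_det_nz f_def)
qed

text \<open>Transposing \<open>matrix_inv A ** A = mat 1\<close> shows that the transposed inverse
  is again a right inverse of \<open>A\<close>.\<close>

lemma transpose_matrix_inv_sym_pos_def:
  assumes "sym_pos_def A"
  shows "transpose (matrix_inv A) = matrix_inv A"
proof -
  have "matrix_inv A ** A = mat 1"
    using sym_pos_def_invertible[OF assms] by (rule matrix_inv_left)
  then have "A ** transpose (matrix_inv A) = mat 1"
    using assms unfolding sym_pos_def_def by (metis matrix_transpose_mul transpose_mat)
  then show ?thesis
    by (metis matrix_inv_eqI)
qed

section \<open>Log-density, losses and gap in terms of the error vector\<close>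

lemma ln_mv_normal_density:
  fixes \<Sigma> :: "real^'n^'n"
  assumes "sym_pos_def \<Sigma>"
  shows "ln (mv_normal_density \<mu> \<Sigma> x)
    = - ((x - \<mu>) \<bullet> (matrix_inv \<Sigma> *v (x - \<mu>))) / 2 - ln (sqrt ((2 * pi) ^ CARD('n) * det \<Sigma>))"
proof -
  have "0 < sqrt ((2 * pi) ^ CARD('n) * det \<Sigma>)"
    using sym_pos_def_det_pos[OF assms] by simp
  then show ?thesis
    by (simp add: mv_normal_density_def ln_divide_pos)
qed

text \<open>Unflattening \<open>v\<close> along \<open>inv \<phi>\<close> and adding it to
  \<open>y\<close> gives the prediction. This turns a vector with non-zero quadratic form into a
  prediction with non-zero gap.\<close>

lemma surj_pred_error:
  assumes "bij \<phi>"
  obtains yhat where "pred_error \<phi> y yhat = v"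
proof
  show "pred_error \<phi> y (y + (\<chi> t d. v $ inv \<phi> (t, d))) = v"
    using assms by (simp add: pred_error_def flatten_def vec_eq_iff bij_is_inj)
qed

lemma loss_df_eq:
  fixes \<phi> :: "'n::finite \<Rightarrow> 't::finite \<times> 'd::finite"
  assumes "bij \<phi>"
  shows "loss_df y yhat
    = 1 / (real CARD('t) * real CARD('d)) * (pred_error \<phi> y yhat \<bullet> pred_error \<phi> y yhat)"
proof -
  have "pred_error \<phi> y yhat \<bullet> pred_error \<phi> y yhat
      = (\<Sum>i\<in>UNIV. (case \<phi> i of (t, d) \<Rightarrow> (yhat $ t $ d - y $ t $ d)\<^sup>2))"
    by (simp add: pred_error_def flatten_def inner_vec_def power2_eq_square case_prod_beta)
  \<comment> \<open>Reindexing along the bijection removes the order of flattening.\<close>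
  also have "\<dots> = (\<Sum>(t, d)\<in>UNIV. (yhat $ t $ d - y $ t $ d)\<^sup>2)"
    using assms by (intro sum.reindex_bij_betw)
  also have "\<dots> = (\<Sum>t\<in>UNIV. \<Sum>d\<in>UNIV. (yhat $ t $ d - y $ t $ d)\<^sup>2)"
    by (simp add: sum.cartesian_product)
  also have "\<dots> = (\<Sum>t\<in>UNIV. (norm (row t y - row t yhat))\<^sup>2)"
    by (simp add: power2_norm_eq_inner inner_vec_def row_def power2_eq_square[symmetric] power2_commute)
  finally show ?thesis
    by (simp add: loss_df_def flip: sum_divide_distrib)
qed

lemma objective_gap_eq:
  fixes \<phi> :: "'n::finite \<Rightarrow> 't::finite \<times> 'd::finite"
  assumes "bij \<phi>"
  shows "objective_gap \<phi> \<Sigma> \<sigma> y yhat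
    = 1 / (2 * real CARD('t) * real CARD('d)) *
        (pred_error \<phi> y yhat \<bullet>
          ((matrix_inv \<Sigma> - (1 / \<sigma>\<^sup>2) *\<^sub>R mat 1) *v pred_error \<phi> y yhat))"
  unfolding objective_gap_def loss_nll_def Let_def loss_df_eq[OF assms]
  by (simp add: matrix_vector_mult_diff_rdistrib inner_diff_right diff_divide_distrib
      flip: scaleR_matrix_vector_assoc)

section \<open>Almost sure non-vanishing under the Gaussian law\<close>

lemma mv_normal_AE_quadratic_form_nonzero:
  fixes B :: "real^'n^'n"
  assumes "prob_space M" and "mv_normal_distributed M X \<mu> \<Sigma>" and "v \<bullet> (B *v v) \<noteq> 0"
  shows "AE \<omega> in M. X \<omega> \<bullet> (B *v X \<omega>) \<noteq> 0"
proof -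
  interpret prob_space M by fact
  have [measurable]: "(\<lambda>x. x \<bullet> (B *v x)) \<in> borel_measurable borel"
    by (intro borel_measurable_continuous_onI continuous_intros linear_continuous_on
        matrix_vector_mul_bounded_linear)
  \<comment> \<open>Negligibility concerns the completed measure, while the density is taken with
    respect to \<open>lborel\<close>; hence the passage through \<open>lebesgue\<close>.\<close>
  have "AE x in lebesgue. x \<bullet> (B *v x) \<noteq> 0"
    using negligible_quadratic_form_zeros[OF assms(3)]
    by (auto simp: negligible_iff_null_sets dest: AE_not_in)
  then have "AE x in lborel. x \<bullet> (B *v x) \<noteq> 0"
    by (simp add: AE_completion_iff)
  then show ?thesis
    using assms(2) unfolding mv_normal_distributed_def
    by (subst distributed_AE2) auto
qed

text \<open>A perfect prediction has gap 0, so a non-zero gap is expressed in two ways: for every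
  truth some prediction attains it, and the random error attains it almost surely.\<close>

theorem theorem3p1:
  fixes \<phi> :: "'n::finite \<Rightarrow> 't::finite \<times> 'd::finite"
    and \<Sigma> :: "real^'n^'n"
    and \<sigma> :: real
    and M :: "'w measure"
    and Y Yhat :: "'w \<Rightarrow> real^'d^'t"
  assumes "bij \<phi>"
    and "sym_pos_def \<Sigma>"
    and "\<sigma>\<^sup>2 > 0"
    and "prob_space M"
    and "mv_normal_distributed M (\<lambda>\<omega>. pred_error \<phi> (Y \<omega>) (Yhat \<omega>)) 0 \<Sigma>"
  shows
    "(\<exists>c. \<forall>y yhat.
        - (1 / (real CARD('t) * real CARD('d))) * ln (mv_normal_density 0 \<Sigma> (pred_error \<phi> y yhat))
          = loss_nll \<phi> \<Sigma> y yhat + c) \<and>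
     (\<forall>y yhat.
        loss_df y yhat
          = 1 / (real CARD('t) * real CARD('d)) * (pred_error \<phi> y yhat \<bullet> pred_error \<phi> y yhat)) \<and>
     (\<exists>c. \<forall>y yhat.
        - (1 / (real CARD('t) * real CARD('d))) *
            ln (mv_normal_density 0 (\<sigma>\<^sup>2 *\<^sub>R mat 1) (pred_error \<phi> y yhat))
          = 1 / (2 * \<sigma>\<^sup>2) * loss_df y yhat + c) \<and>
     (\<forall>y yhat.
        objective_gap \<phi> \<Sigma> \<sigma> y yhat
          = 1 / (2 * real CARD('t) * real CARD('d)) *
              (pred_error \<phi> y yhat \<bullet>
                ((matrix_inv \<Sigma> - (1 / \<sigma>\<^sup>2) *\<^sub>R mat 1) *v pred_error \<phi> y yhat))) \<and>
     ((\<exists>i j. i \<noteq> j \<and> matrix_inv \<Sigma> $ i $ j \<noteq> 0) \<longrightarrow>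
        matrix_inv \<Sigma> \<noteq> (1 / \<sigma>\<^sup>2) *\<^sub>R mat 1 \<and>
        (\<forall>y. \<exists>yhat. objective_gap \<phi> \<Sigma> \<sigma> y yhat \<noteq> 0) \<and>
        (AE \<omega> in M. objective_gap \<phi> \<Sigma> \<sigma> (Y \<omega>) (Yhat \<omega>) \<noteq> 0))"
proof -
  define k where "k = real CARD('t) * real CARD('d)"
  define B where "B = matrix_inv \<Sigma> - (1 / \<sigma>\<^sup>2) *\<^sub>R mat 1"
  have k: "k > 0"
    by (simp add: k_def)
  \<comment> \<open>Kept general in \<open>S\<close> to serve both \<Sigma> and the isotropic
    covariance. The constant is the logarithm of the normalizer divided by \<open>k\<close>.\<close>
  have nll: "\<exists>c. \<forall>y yhat.
      - (1 / k) * ln (mv_normal_density 0 S (pred_error \<phi> y yhat)) = loss_nll \<phi> S y yhat + c"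
    if "sym_pos_def S" for S
    by (rule exI[of _ "ln (sqrt ((2 * pi) ^ CARD('n) * det S)) / k"])
      (simp add: ln_mv_normal_density[OF that] loss_nll_def Let_def k_def diff_divide_distrib)
  have iso: "loss_nll \<phi> (\<sigma>\<^sup>2 *\<^sub>R mat 1) y yhat = 1 / (2 * \<sigma>\<^sup>2) * loss_df y yhat" for y yhat
    using assms(3)
    by (simp add: loss_nll_def Let_def loss_df_eq[OF assms(1)] matrix_inv_scaled_identity
        flip: scaleR_matrix_vector_assoc)
  have gap: "objective_gap \<phi> \<Sigma> \<sigma> y yhat
      = 1 / (2 * k) * (pred_error \<phi> y yhat \<bullet> (B *v pred_error \<phi> y yhat))" for y yhat
    by (simp add: objective_gap_eq[OF assms(1)] B_def k_def)
  have dep: "matrix_inv \<Sigma> \<noteq> (1 / \<sigma>\<^sup>2) *\<^sub>R mat 1 \<and>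
      (\<forall>y. \<exists>yhat. objective_gap \<phi> \<Sigma> \<sigma> y yhat \<noteq> 0) \<and>
      (AE \<omega> in M. objective_gap \<phi> \<Sigma> \<sigma> (Y \<omega>) (Yhat \<omega>) \<noteq> 0)"
    if "i \<noteq> j" "matrix_inv \<Sigma> $ i $ j \<noteq> 0" for i j
  proof -
    \<comment> \<open>Subtracting a multiple of the identity leaves off-diagonal entries
      unchanged.\<close>
    have Bij: "B $ i $ j \<noteq> 0"
      using that by (simp add: B_def mat_def)
    have "matrix_inv \<Sigma> $ b $ a = matrix_inv \<Sigma> $ a $ b" for a b
      using transpose_matrix_inv_sym_pos_def[OF assms(2)] by (metis transpose_def vec_lambda_beta)
    then have "transpose B = B"
      by (simp add: B_def transpose_def vec_eq_iff mat_def)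
    then obtain v where v: "v \<bullet> (B *v v) \<noteq> 0"
      using Bij by (rule symmetric_quadratic_form_nonzero)
    have "matrix_inv \<Sigma> \<noteq> (1 / \<sigma>\<^sup>2) *\<^sub>R mat 1"
      using Bij by (auto simp: B_def)
    moreover have "\<exists>yhat. objective_gap \<phi> \<Sigma> \<sigma> y yhat \<noteq> 0" for y
      using surj_pred_error[OF assms(1), of y v] v k unfolding gap by fastforce
    moreover have "AE \<omega> in M. objective_gap \<phi> \<Sigma> \<sigma> (Y \<omega>) (Yhat \<omega>) \<noteq> 0"
      using mv_normal_AE_quadratic_form_nonzero[OF assms(4,5) v] k by (simp add: gap)
    ultimately show ?thesis
      by blast
  qed
  show ?thesis
    using nll[OF assms(2)] nll[OF sym_pos_def_scaled_identity[OF assms(3)]]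
      loss_df_eq[OF assms(1)] objective_gap_eq[OF assms(1)] dep
    unfolding iso k_def by blast
qed

end
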